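(* Let $G$ be a finite abelian group (written additively) of order $|G|$, and let $D\subseteq G$ be a subset with $|D|=|G|-c\geq c$. Let $b\in G$ and let $k$ be an integer with $0\le k\le |D|$. Let $N(D,k,b)$ be the number of $k$-element subsets $S\subseteq D$ such that $\sum_{x\in S}x=b$. Then $$\left| N(D, k, b)-\frac{1}{|G|}\binom{|G|-c}{k}\right|\leq \binom{c + (|G|-2c)\left(\sum_{i\mid e(G),\ \mu(i)=-1}\frac {1}{i}\right)+k-1}{k},$$ where $e(G)$ is the exponent of $G$ (the maximal order of an element of $G$).
   Context: For a real number $x$ and an integer $k\ge 0$, $\binom{x}{k}=\frac{(x)_k}{k!}$ with $(x)_0=1$ and $(x)_k=x(x-1)\cdots(x-k+1)$ for $k\geq 1$. $\mu$ is the Möbius function, and the sum $\sum_{i\mid e(G),\,\mu(i)=-1}\frac1i$ runs over the positive divisors $i$ of $e(G)$ with $\mu(i)=-1$. *)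

theory Defs
  imports
    Complex_Main
    "HOL-Algebra.Multiplicative_Group"
    "HOL-Computational_Algebra.Squarefree"
begin

definition moebius_mu :: "nat \<Rightarrow> int" where
  "moebius_mu n = (if squarefree n then (-1) ^ card (prime_factors n) else 0)"

text \<open>Meaningful for finite groups only: there the set of element orders is finite and nonempty.\<close>
definition group_exponent :: "('a, 'b) monoid_scheme \<Rightarrow> nat" where
  "group_exponent G = Max (group.ord G ` carrier G)"

text \<open>
  The abelian group is an Algebra-library \<^locale>\<open>comm_group\<close>, whose operation is written
  multiplicatively, so \<^const>\<open>finprod\<close> of the identity is the sum of the elements of \<open>S\<close>.
\<close>
definition subset_sum_count ::
  "('a, 'b) monoid_scheme \<Rightarrow> 'a set \<Rightarrow> nat \<Rightarrow> 'a \<Rightarrow> nat" where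
  "subset_sum_count G D k b =
     card {S. S \<subseteq> D \<and> card S = k \<and> finprod G (\<lambda>x. x) S = b}"

end

theory Submission
  imports Defs "HOL-Computational_Algebra.Formal_Power_Series"
begin

text \<open>
  By orthogonality of characters, \<open>|G| N(D, k, b)\<close> is the sum over the characters \<open>\<chi>\<close> of \<open>G\<close> of
  \<open>\<chi>(-b) e\<^sub>k(\<chi>|D)\<close>, with \<open>e\<^sub>k\<close> the elementary symmetric function; the trivial character gives the main
  term. If \<open>\<chi>\<close> has order \<open>d > 1\<close>, the power sum \<open>p\<^sub>j\<close> of its values on \<open>D\<close> has modulus at most \<open>c\<close> unless
  \<open>d\<close> divides \<open>j\<close>, when it equals \<open>c + m\<close> with \<open>m = |G| - 2c\<close>. Newton's identities and induction bound
  \<open>|e\<^sub>k|\<close> by \<open>x(x+1)...(x+k-1)/k!\<close> for any \<open>x \<ge> 1\<close> with \<open>x \<ge> c + m/d\<close>. The given \<open>x\<close> qualifies because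
  its sum over divisors contains the term \<open>1/p \<ge> 1/d\<close> for a prime \<open>p\<close> dividing \<open>d\<close>.
\<close>

subsection \<open>Characters of finite abelian groups\<close>

text \<open>The condition at the identity excludes the zero function. On a subgroup it forces every
  value to be nonzero, as the value at the inverse is its reciprocal.\<close>

definition char_on :: "('a, 'b) monoid_scheme \<Rightarrow> 'a set \<Rightarrow> ('a \<Rightarrow> complex) \<Rightarrow> bool" where
  "char_on G H \<chi> \<longleftrightarrow> \<chi> \<one>\<^bsub>G\<^esub> = 1 \<and> (\<forall>x\<in>H. \<forall>y\<in>H. \<chi> (x \<otimes>\<^bsub>G\<^esub> y) = \<chi> x * \<chi> y)"

text \<open>Extensionality identifies functions that agree on \<open>carrier G\<close>, so that
  characters of a finite group can be counted.\<close>

definition characters :: "('a, 'b) monoid_scheme \<Rightarrow> ('a \<Rightarrow> complex) set" where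
  "characters G = {\<chi> \<in> extensional (carrier G). char_on G (carrier G) \<chi>}"

text \<open>In a finite group the inverse of \<open>x\<close> is the power
  \<open>x [^] (order G - 1)\<close>, so closure under products yields closure under
  inverses.\<close>

lemma (in group) finite_submonoid_subgroup:
  assumes fin: "finite (carrier G)" and H: "H \<subseteq> carrier G" "\<one> \<in> H"
    and mult: "\<And>x y. x \<in> H \<Longrightarrow> y \<in> H \<Longrightarrow> x \<otimes> y \<in> H"
  shows "subgroup H G"
proof (rule subgroupI)
  show "inv x \<in> H" if x: "x \<in> H" for x
  proof -
    have pow: "x [^] (i::nat) \<in> H" for i
      by (induction i) (use x H mult in auto)
    have xc: "x \<in> carrier G" using x H by auto
    have "order G > 0" using fin by (simp add: order_gt_0_iff_finite)
    then have "x [^] (order G - 1) \<otimes> x = x [^] order G"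
      by (metis Suc_diff_1 nat_pow_Suc)
    also have "\<dots> = \<one>" using xc by (rule pow_order_eq_1)
    finally have "inv x = x [^] (order G - 1)"
      using xc by (metis inv_equality nat_pow_closed)
    then show ?thesis using pow by simp
  qed
qed (use H mult in auto)

lemma (in monoid) char_on_pow:
  assumes "char_on G H \<chi>" "x \<in> H" "\<And>i::nat. x [^] i \<in> H"
  shows "\<chi> (x [^] (i::nat)) = \<chi> x ^ i"
  by (induction i) (use assms in \<open>auto simp: char_on_def\<close>)

text \<open>The only obstruction to prescribing \<open>\<chi> g = w\<close> is the first power of \<open>g\<close> that lies in \<open>H\<close>.\<close>

lemma (in comm_group) char_on_extend:
  assumes fin: "finite (carrier G)" and H: "subgroup H G" and \<chi>: "char_on G H \<chi>"
    and g: "g \<in> carrier G" and k: "k = (LEAST k::nat. k > 0 \<and> g [^] k \<in> H)"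
    and w: "w ^ k = \<chi> (g [^] k)"
  obtains K \<psi> where "subgroup K G" "char_on G K \<psi>" "insert g H \<subseteq> K" "\<psi> g = w"
    "\<And>x. x \<in> H \<Longrightarrow> \<psi> x = \<chi> x"
proof -
  note Hc = subgroup.mem_carrier[OF H] and H1 = subgroup.one_closed[OF H]
    and Hm = subgroup.m_closed[OF H] and Hi = subgroup.m_inv_closed[OF H]
  have "order G > 0 \<and> g [^] order G \<in> H"
    using fin g H1 by (simp add: order_gt_0_iff_finite pow_order_eq_1)
  then have k0: "k > 0" and gk: "g [^] k \<in> H"
    using LeastI[of "\<lambda>k::nat. k > 0 \<and> g [^] k \<in> H"] unfolding k by blast+
  have Hpow: "x [^] (i::nat) \<in> H" if "x \<in> H" for x i
    by (induction i) (use that H1 Hm in auto)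
  \<comment> \<open>By minimality of \<open>k\<close>, an exponent \<open>i\<close> with
    \<open>g [^] i \<in> H\<close> is a multiple of \<open>k\<close>: a nonzero remainder would be a
    smaller positive exponent. Hence the choice of \<open>w\<close> agrees with
    \<open>\<chi>\<close> on all powers of \<open>g\<close> in \<open>H\<close>.\<close>
  have gpow: "\<chi> (g [^] i) = w ^ i" if i: "g [^] i \<in> H" for i :: nat
  proof -
    have split: "g [^] i = (g [^] k) [^] (i div k) \<otimes> g [^] (i mod k)"
      using g by (simp add: nat_pow_pow nat_pow_mult)
    have "g [^] (i mod k) = inv ((g [^] k) [^] (i div k)) \<otimes> g [^] i"
      unfolding split using g by (simp add: inv_solve_left)
    then have "g [^] (i mod k) \<in> H"
      using i gk by (simp add: Hm Hi Hpow)
    then have "i mod k = 0"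
      using not_less_Least[of "i mod k" "\<lambda>k::nat. k > 0 \<and> g [^] k \<in> H"] k0
      unfolding k[symmetric] by auto
    then have eq: "i = k * (i div k)" and "g [^] i = (g [^] k) [^] (i div k)"
      using split g by auto
    then have "\<chi> (g [^] i) = \<chi> (g [^] k) ^ (i div k)"
      using char_on_pow[OF \<chi>] gk Hpow by simp
    also have "\<dots> = w ^ i" by (simp only: w[symmetric] power_mult[symmetric] eq[symmetric])
    finally show ?thesis .
  qed
  \<comment> \<open>Two representations of one element differ by the power
    \<open>g [^] (j - i)\<close>, which lies in \<open>H\<close>, where \<open>gpow\<close>
    determines the value.\<close>
  have wd_le: "\<chi> h * w ^ i = \<chi> h' * w ^ j"
    if h: "h \<in> H" "h' \<in> H" and e: "h \<otimes> g [^] i = h' \<otimes> g [^] j" and "i \<le> j" for h h' and i j :: nat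
  proof -
    have "h \<otimes> g [^] i = (h' \<otimes> g [^] (j - i)) \<otimes> g [^] i"
      using e \<open>i \<le> j\<close> g h Hc by (simp add: m_assoc nat_pow_mult)
    then have eh: "h = h' \<otimes> g [^] (j - i)"
      using g h Hc by (metis m_closed nat_pow_closed right_cancel)
    then have "g [^] (j - i) = inv h' \<otimes> h"
      using g h Hc by (simp add: inv_solve_left)
    then have m: "g [^] (j - i) \<in> H" using h Hm Hi by simp
    have "\<chi> h = \<chi> h' * w ^ (j - i)"
      using eh h m gpow[OF m] \<chi> by (simp add: char_on_def)
    then show ?thesis using \<open>i \<le> j\<close> by (simp add: power_add[symmetric] mult.assoc)
  qed
  have wd: "\<chi> h * w ^ i = \<chi> h' * w ^ j"
    if "h \<in> H" "h' \<in> H" "h \<otimes> g [^] i = h' \<otimes> g [^] j" for h h' and i j :: nat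
    using wd_le[of h h' i j] wd_le[of h' h j i] that by (cases "i \<le> j") auto
  define K where "K = {h \<otimes> g [^] (i::nat) | h i. h \<in> H}"
  \<comment> \<open>For \<open>z \<in> K\<close> all candidates \<open>v\<close> coincide by
    \<open>wd\<close>, so the choice returns the intended value.\<close>
  define \<psi> where "\<psi> z = (SOME v. \<exists>h i. h \<in> H \<and> z = h \<otimes> g [^] (i::nat) \<and> v = \<chi> h * w ^ i)" for z
  have \<psi>: "\<psi> (h \<otimes> g [^] i) = \<chi> h * w ^ i" if "h \<in> H" for h and i :: nat
    unfolding \<psi>_def by (rule some1_equality) (use that wd in \<open>metis+\<close>)
  have prod: "(h \<otimes> g [^] i) \<otimes> (h' \<otimes> g [^] j) = (h \<otimes> h') \<otimes> g [^] (i + j)"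
    if "h \<in> H" "h' \<in> H" for h h' and i j :: nat
    using that g Hc by (simp add: nat_pow_mult[symmetric] m_ac)
  have \<psi>H: "\<psi> x = \<chi> x" if "x \<in> H" for x
    using \<psi>[OF that, of 0] that Hc by simp
  show ?thesis
  proof
    show "subgroup K G"
    proof (rule finite_submonoid_subgroup[OF fin])
      show "K \<subseteq> carrier G" using Hc g by (auto simp: K_def)
      show "\<one> \<in> K" unfolding K_def using H1 by (auto intro!: exI[of _ \<one>] exI[of _ "0::nat"])
      show "x \<otimes> y \<in> K" if "x \<in> K" "y \<in> K" for x y
        using that prod Hm unfolding K_def by fast
    qed
    show "char_on G K \<psi>"
      unfolding char_on_def
    proof (intro conjI ballI)
      show "\<psi> \<one> = 1" using \<psi>H[OF H1] \<chi> by (simp add: char_on_def)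
      fix x y assume "x \<in> K" "y \<in> K"
      then obtain h h' i j where *: "x = h \<otimes> g [^] (i::nat)" "y = h' \<otimes> g [^] (j::nat)" "h \<in> H" "h' \<in> H"
        unfolding K_def by blast
      then show "\<psi> (x \<otimes> y) = \<psi> x * \<psi> y"
        using \<chi> by (simp add: prod \<psi> Hm char_on_def power_add)
    qed
    show "insert g H \<subseteq> K"
    proof
      fix x assume "x \<in> insert g H"
      moreover have "g = \<one> \<otimes> g [^] (1::nat)" using g by simp
      moreover have "x = x \<otimes> g [^] (0::nat)" if "x \<in> H" using that Hc by simp
      ultimately show "x \<in> K" unfolding K_def using H1 by blast
    qed
    show "\<psi> g = w" using \<psi>[OF H1, of 1] g \<chi> by (simp add: char_on_def)
  qed (fact \<psi>H)
qed

lemma complex_root_exists: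
  assumes "k > 0" "z \<noteq> 0"
  shows "\<exists>w::complex. w ^ k = z"
  using card_nth_roots[OF assms(2,1)] assms(1) by (metis (mono_tags, lifting) Collect_empty_eq card.empty less_irrefl)

text \<open>Elements are adjoined one at a time: the value sought at \<open>g\<close> is a root of a
  nonzero complex number, which always exists. Each step shrinks the complement of
  \<open>H\<close>.\<close>

lemma (in comm_group) char_on_extend_carrier:
  assumes fin: "finite (carrier G)"
  shows "subgroup H G \<Longrightarrow> char_on G H \<chi> \<Longrightarrow>
    \<exists>\<psi>. char_on G (carrier G) \<psi> \<and> (\<forall>x\<in>H. \<psi> x = \<chi> x)"
proof (induction "card (carrier G - H)" arbitrary: H \<chi> rule: less_induct)
  case less
  note H = less.prems(1) and \<chi> = less.prems(2)
  show ?case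
  proof (cases "H = carrier G")
    case False
    then obtain g where g: "g \<in> carrier G" "g \<notin> H"
      using subgroup.subset[OF H] by blast
    define k where "k = (LEAST k::nat. k > 0 \<and> g [^] k \<in> H)"
    have "order G > 0 \<and> g [^] order G \<in> H"
      using fin g subgroup.one_closed[OF H] by (simp add: order_gt_0_iff_finite pow_order_eq_1)
    then have k: "k > 0" "g [^] k \<in> H"
      using LeastI[of "\<lambda>k::nat. k > 0 \<and> g [^] k \<in> H"] unfolding k_def by blast+
    have "\<chi> (g [^] k) * \<chi> (inv (g [^] k)) = \<chi> (g [^] k \<otimes> inv (g [^] k))"
      using \<chi> k subgroup.m_inv_closed[OF H] unfolding char_on_def by metis
    also have "\<dots> = 1" using g \<chi> by (simp add: char_on_def)
    finally have "\<chi> (g [^] k) \<noteq> 0" by auto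
    then obtain w where "w ^ k = \<chi> (g [^] k)" using complex_root_exists k by blast
    from char_on_extend[OF fin H \<chi> g(1) k_def this]
    obtain K \<psi> where K: "subgroup K G" "char_on G K \<psi>" "insert g H \<subseteq> K"
      "\<And>x. x \<in> H \<Longrightarrow> \<psi> x = \<chi> x" by metis
    have "card (carrier G - K) < card (carrier G - H)"
      using fin g K(3) by (intro psubset_card_mono) auto
    from less.hyps[OF this K(1,2)] show ?thesis using K(3,4) by (metis insert_subset subsetD)
  qed (use \<chi> in auto)
qed

lemma char_on_restrict:
  assumes "group G" "char_on G (carrier G) \<chi>"
  shows "restrict \<chi> (carrier G) \<in> characters G"
proof -
  interpret group G by fact
  show ?thesis using assms(2) by (auto simp: characters_def char_on_def)
qed

text \<open>Over the trivial subgroup the least exponent \<open>k\<close> is the order of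
  \<open>a\<close>. It exceeds 1, so \<open>a\<close> can be sent to a \<open>k\<close>-th root of
  unity other than 1, and the result extends to \<open>G\<close>.\<close>

lemma (in comm_group) characters_separate:
  assumes fin: "finite (carrier G)" and a: "a \<in> carrier G" "a \<noteq> \<one>"
  shows "\<exists>\<chi>\<in>characters G. \<chi> a \<noteq> 1"
proof -
  have H: "subgroup {\<one>} G" by (rule triv_subgroup)
  have triv: "char_on G {\<one>} (\<lambda>_. 1)" by (simp add: char_on_def)
  define k where "k = (LEAST k::nat. k > 0 \<and> a [^] k \<in> {\<one>})"
  have "order G > 0 \<and> a [^] order G \<in> {\<one>}"
    using fin a by (simp add: order_gt_0_iff_finite pow_order_eq_1)
  then have k: "k > 0" "a [^] k \<in> {\<one>}"
    using LeastI[of "\<lambda>k::nat. k > 0 \<and> a [^] k \<in> {\<one>}"] unfolding k_def by blast+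
  have "k \<noteq> 1" using k(2) a by auto
  then have "card {z::complex. z ^ k = 1} \<noteq> card {1::complex}"
    using k(1) by (simp add: card_roots_unity_eq)
  then obtain w :: complex where w: "w ^ k = 1" "w \<noteq> 1"
    by (metis (mono_tags, lifting) Collect_cong mem_Collect_eq power_one singleton_conv)
  obtain K \<psi> where K: "subgroup K G" "char_on G K \<psi>" "insert a {\<one>} \<subseteq> K" "\<psi> a = w"
    using char_on_extend[OF fin H triv a(1) k_def] w(1) by metis
  then obtain \<phi> where "char_on G (carrier G) \<phi>" "\<phi> a = w"
    using char_on_extend_carrier[OF fin K(1,2)] by auto
  then show ?thesis
    using w a by (intro bexI[OF _ char_on_restrict]) (auto intro: is_group)
qed

section \<open>Orthogonality of characters\<close>

context comm_group begin

context
  fixes \<chi>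
  assumes \<chi>: "\<chi> \<in> characters G"
begin

lemma char_one: "\<chi> \<one> = 1"
  using \<chi> by (simp add: characters_def char_on_def)

lemma char_mult: "x \<in> carrier G \<Longrightarrow> y \<in> carrier G \<Longrightarrow> \<chi> (x \<otimes> y) = \<chi> x * \<chi> y"
  using \<chi> by (simp add: characters_def char_on_def)

lemma char_pow: "x \<in> carrier G \<Longrightarrow> \<chi> (x [^] (i::nat)) = \<chi> x ^ i"
  by (induction i) (auto simp: char_one char_mult)

lemma char_pow_order: "x \<in> carrier G \<Longrightarrow> \<chi> x ^ order G = 1"
  using char_pow[of x "order G"] by (simp add: pow_order_eq_1 char_one)

lemma char_finprod: "S \<subseteq> carrier G \<Longrightarrow> \<chi> (finprod G (\<lambda>x. x) S) = (\<Prod>x\<in>S. \<chi> x)"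
proof (induction S rule: infinite_finite_induct)
  case (insert x F)
  then show ?case
    by (subst finprod_insert) (auto simp: char_mult Pi_iff subset_iff)
qed (auto simp: char_one)

lemma char_norm:
  assumes "finite (carrier G)" "x \<in> carrier G"
  shows "norm (\<chi> x) = 1"
proof -
  have "norm (\<chi> x) ^ order G = 1"
    using char_pow_order[OF assms(2)] by (simp flip: norm_power)
  then show ?thesis
    using assms(1) by (metis norm_ge_zero order_gt_0_iff_finite power_eq_1_iff less_irrefl real_norm_def abs_norm_cancel)
qed

text \<open>Translation by \<open>y\<close> permutes the carrier and multiplies the sum by
  \<open>\<chi> y\<close>, a factor different from 1.\<close>

lemma char_sum_carrier:
  assumes fin: "finite (carrier G)" and y: "y \<in> carrier G" "\<chi> y \<noteq> 1"
  shows "(\<Sum>x\<in>carrier G. \<chi> x) = 0"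
proof -
  have "(\<Sum>x\<in>carrier G. \<chi> x) = (\<Sum>x\<in>carrier G. \<chi> (y \<otimes> x))"
    by (rule sum.reindex_bij_witness[of _ "\<lambda>x. y \<otimes> x" "\<lambda>x. inv y \<otimes> x"])
      (use y in \<open>auto simp: m_assoc[symmetric]\<close>)
  also have "\<dots> = \<chi> y * (\<Sum>x\<in>carrier G. \<chi> x)"
    by (simp add: sum_distrib_left char_mult y)
  finally show ?thesis using y by auto
qed

lemma char_power_character: "(\<lambda>x\<in>carrier G. \<chi> x ^ j) \<in> characters G"
  using \<chi> by (auto simp: characters_def char_on_def power_mult_distrib)

end

lemma finite_characters:
  assumes "finite (carrier G)"
  shows "finite (characters G)"
proof (rule finite_subset)
  show "characters G \<subseteq> (\<Pi>\<^sub>E x\<in>carrier G. {z. z ^ order G = 1})"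
    using char_pow_order by (auto simp: PiE_iff) (auto simp: characters_def extensional_def)
  show "finite (\<Pi>\<^sub>E x\<in>carrier G. {z::complex. z ^ order G = 1})"
    using assms finite_roots_unity[of "order G"] order_gt_0_iff_finite
    by (intro finite_PiE) (auto simp: Suc_le_eq)
qed

definition trivial_char :: "'a \<Rightarrow> complex" where
  "trivial_char = (\<lambda>x\<in>carrier G. 1)"

lemma trivial_char_in: "trivial_char \<in> characters G"
  by (auto simp: characters_def char_on_def trivial_char_def)

lemma char_nontrivialE:
  assumes "\<chi> \<in> characters G" "\<chi> \<noteq> trivial_char"
  obtains y where "y \<in> carrier G" "\<chi> y \<noteq> 1"
proof -
  have "\<chi> = trivial_char" if "\<And>y. y \<in> carrier G \<Longrightarrow> \<chi> y = 1"
    using assms(1) that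
    by (intro extensionalityI[of _ "carrier G"]) (auto simp: characters_def trivial_char_def)
  then show ?thesis using assms(2) that by blast
qed

text \<open>Dual to \<open>char_sum_carrier\<close>: multiplication by a character
  \<open>\<psi>\<close> with \<open>\<psi> a \<noteq> 1\<close> permutes the characters and scales
  the sum by \<open>\<psi> a\<close>.\<close>

lemma sum_characters_nontrivial:
  assumes fin: "finite (carrier G)" and a: "a \<in> carrier G" "a \<noteq> \<one>"
  shows "(\<Sum>\<chi>\<in>characters G. \<chi> a) = 0"
proof -
  obtain \<psi> where \<psi>: "\<psi> \<in> characters G" "\<psi> a \<noteq> 1"
    using characters_separate[OF fin a] by blast
  define f where "f \<chi> = (\<lambda>x\<in>carrier G. \<psi> x * \<chi> x)" for \<chi> :: "'a \<Rightarrow> complex"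
  have nz: "\<psi> x \<noteq> 0" if "x \<in> carrier G" for x
    using char_norm[OF \<psi>(1) fin that] by auto
  have inj: "inj_on f (characters G)"
  proof (rule inj_onI)
    fix \<chi> \<chi>' assume *: "\<chi> \<in> characters G" "\<chi>' \<in> characters G" "f \<chi> = f \<chi>'"
    have "\<chi> x = \<chi>' x" if "x \<in> carrier G" for x
      using fun_cong[OF *(3), of x] that nz by (simp add: f_def)
    then show "\<chi> = \<chi>'"
      using * by (intro extensionalityI[of _ "carrier G"]) (auto simp: characters_def)
  qed
  have "f ` characters G \<subseteq> characters G"
    using \<psi>(1) by (auto simp: f_def characters_def char_on_def)
  then have im: "f ` characters G = characters G"
    using endo_inj_surj[OF finite_characters[OF fin] _ inj] by simp
  have "(\<Sum>\<chi>\<in>characters G. \<chi> a) = (\<Sum>\<chi>\<in>f ` characters G. \<chi> a)"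
    by (simp add: im)
  also have "\<dots> = \<psi> a * (\<Sum>\<chi>\<in>characters G. \<chi> a)"
    using a by (simp add: sum.reindex[OF inj] sum_distrib_left) (simp add: f_def)
  finally show ?thesis using \<psi>(2) by auto
qed

text \<open>Summing all character values over the group in both orders.\<close>

lemma card_characters:
  assumes fin: "finite (carrier G)"
  shows "card (characters G) = order G"
proof -
  have "(\<Sum>\<chi>\<in>characters G. \<Sum>x\<in>carrier G. \<chi> x)
      = (\<Sum>\<chi>\<in>characters G. if \<chi> = trivial_char then of_nat (order G) else 0)"
  proof (rule sum.cong[OF refl])
    fix \<chi> assume \<chi>: "\<chi> \<in> characters G"
    show "(\<Sum>x\<in>carrier G. \<chi> x) = (if \<chi> = trivial_char then of_nat (order G) else 0)"
      using char_sum_carrier[OF \<chi> fin] char_nontrivialE[OF \<chi>]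
      by (auto simp: trivial_char_def order_def)
  qed
  also have "\<dots> = of_nat (order G)"
    using trivial_char_in finite_characters[OF fin] by simp
  finally have 1: "(\<Sum>\<chi>\<in>characters G. \<Sum>x\<in>carrier G. \<chi> x) = of_nat (order G)" .
  have "(\<Sum>\<chi>\<in>characters G. \<Sum>x\<in>carrier G. \<chi> x) = (\<Sum>x\<in>carrier G. \<Sum>\<chi>\<in>characters G. \<chi> x)"
    by (rule sum.swap)
  also have "\<dots> = (\<Sum>x\<in>carrier G. if x = \<one> then of_nat (card (characters G)) else 0)"
    by (intro sum.cong refl) (auto simp: char_one sum_characters_nontrivial[OF fin])
  also have "\<dots> = of_nat (card (characters G))"
    using fin by simp
  finally show ?thesis using 1 by (metis of_nat_eq_iff)
qed

lemma sum_characters: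
  assumes "finite (carrier G)" "a \<in> carrier G"
  shows "(\<Sum>\<chi>\<in>characters G. \<chi> a) = (if a = \<one> then of_nat (order G) else 0)"
  using assms by (simp add: char_one sum_characters_nontrivial card_characters)

text \<open>Each summand is the value of \<open>\<chi>\<close> at \<open>inv b\<close> times the
  product of \<open>S\<close> in \<open>G\<close>. Summing over \<open>\<chi>\<close> first leaves
  \<open>order G\<close> for the sets \<open>S\<close> whose product is \<open>b\<close>, and 0 for
  the others.\<close>

lemma subset_sum_count_characters:
  assumes fin: "finite (carrier G)" and D: "D \<subseteq> carrier G" and b: "b \<in> carrier G"
  shows "of_nat (order G) * of_nat (subset_sum_count G D k b)
    = (\<Sum>\<chi>\<in>characters G. \<chi> (inv b) * (\<Sum>S | S \<subseteq> D \<and> card S = k. \<Prod>x\<in>S. \<chi> x))"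
proof -
  define P where "P S = finprod G (\<lambda>x. x) S" for S
  have finD: "finite {S. S \<subseteq> D \<and> card S = k}"
    by (rule finite_subset[of _ "Pow D"]) (use finite_subset[OF D fin] in auto)
  have P: "P S \<in> carrier G" if "S \<subseteq> D" for S
    using that D unfolding P_def by (intro finprod_closed) auto
  have "(\<Sum>\<chi>\<in>characters G. \<chi> (inv b) * (\<Sum>S | S \<subseteq> D \<and> card S = k. \<Prod>x\<in>S. \<chi> x))
      = (\<Sum>\<chi>\<in>characters G. \<Sum>S | S \<subseteq> D \<and> card S = k. \<chi> (inv b \<otimes> P S))"
    unfolding sum_distrib_left
  proof (intro sum.cong refl)
    fix \<chi> S assume "\<chi> \<in> characters G" "S \<in> {S. S \<subseteq> D \<and> card S = k}"
    then show "\<chi> (inv b) * (\<Prod>x\<in>S. \<chi> x) = \<chi> (inv b \<otimes> P S)"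
      using P b D char_finprod[of \<chi> S] char_mult[of \<chi> "inv b" "P S"] subset_trans[of S D "carrier G"]
      by (auto simp: P_def)
  qed
  also have "\<dots> = (\<Sum>S | S \<subseteq> D \<and> card S = k. \<Sum>\<chi>\<in>characters G. \<chi> (inv b \<otimes> P S))"
    by (rule sum.swap)
  also have "\<dots> = (\<Sum>S | S \<subseteq> D \<and> card S = k. if P S = b then of_nat (order G) else 0)"
  proof (intro sum.cong refl)
    fix S assume S: "S \<in> {S. S \<subseteq> D \<and> card S = k}"
    have "inv b \<otimes> P S = \<one> \<longleftrightarrow> P S = b"
      using S P b by (metis (mono_tags, lifting) inv_solve_left mem_Collect_eq one_closed r_one)
    then show "(\<Sum>\<chi>\<in>characters G. \<chi> (inv b \<otimes> P S)) = (if P S = b then of_nat (order G) else 0)"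
      using S P b by (subst sum_characters[OF fin]) auto
  qed
  also have "\<dots> = of_nat (order G) * of_nat (card {S. (S \<subseteq> D \<and> card S = k) \<and> P S = b})"
    by (simp add: sum.If_cases[OF finD] Collect_conj_eq[symmetric] Int_def conj_ac)
  finally show ?thesis
    by (simp add: subset_sum_count_def P_def conj_assoc)
qed

end

subsection \<open>Elementary symmetric functions and power sums\<close>

text \<open>Indexing by subsets of \<open>D\<close>, not by values of \<open>f\<close>, counts equal
  values with multiplicity.\<close>

definition esym :: "nat \<Rightarrow> 'a set \<Rightarrow> ('a \<Rightarrow> 'b::comm_ring_1) \<Rightarrow> 'b" where
  "esym k D f = (\<Sum>S | S \<subseteq> D \<and> card S = k. \<Prod>x\<in>S. f x)"

text \<open>When the product is expanded, \<open>S\<close> records the factors that contribute their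
  linear term.\<close>

lemma fps_nth_prod_esym:
  fixes f :: "'a \<Rightarrow> 'b::comm_ring_1"
  assumes "finite D"
  shows "fps_nth (\<Prod>x\<in>D. 1 + fps_const (f x) * fps_X) k = esym k D f"
proof -
  have const: "(\<Prod>x\<in>S. fps_const (f x)) = fps_const (\<Prod>x\<in>S. f x)" for S
    by (induction S rule: infinite_finite_induct) auto
  have "(\<Prod>x\<in>D. 1 + fps_const (f x) * fps_X) = (\<Prod>x\<in>D. fps_const (f x) * fps_X + 1)"
    by (simp add: add.commute)
  also have "\<dots> = (\<Sum>S\<in>Pow D. fps_const (\<Prod>x\<in>S. f x) * fps_X ^ card S)"
    by (simp add: prod_add[OF assms] prod.distrib const)
  finally have "fps_nth (\<Prod>x\<in>D. 1 + fps_const (f x) * fps_X) k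
      = (\<Sum>S\<in>Pow D. if k = card S then \<Prod>x\<in>S. f x else 0)"
    by (simp add: fps_sum_nth if_distrib cong: if_cong)
  also have "\<dots> = esym k D f"
    using assms by (simp add: sum.If_cases esym_def Int_def eq_commute)
  finally show ?thesis .
qed

text \<open>With \<open>E\<close> the generating function of the \<open>esym k D f\<close> and
  \<open>P\<close> that of the signed power sums, \<open>P\<close> is the logarithmic derivative of
  \<open>E\<close>. The identity compares coefficients in
  \<open>fps_deriv (E D) = E D * P D\<close>.\<close>

lemma newton_identity:
  fixes f :: "'a \<Rightarrow> 'b::comm_ring_1"
  assumes "finite D"
  shows "of_nat (Suc k) * esym (Suc k) D f
    = (\<Sum>i\<le>k. esym i D f * ((-1) ^ (k - i) * (\<Sum>x\<in>D. f x ^ Suc (k - i))))"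
proof -
  define E where "E A = (\<Prod>x\<in>A. 1 + fps_const (f x) * fps_X)" for A
  define P where "P A = Abs_fps (\<lambda>j. (-1) ^ j * (\<Sum>x\<in>A. f x ^ Suc j))" for A
  \<comment> \<open>The geometric series for \<open>a / (1 + a X)\<close>, the logarithmic
    derivative of a single factor.\<close>
  have geom: "(1 + fps_const a * fps_X) * Abs_fps (\<lambda>j. (-1) ^ j * a ^ Suc j) = fps_const a" for a :: 'b
  proof (rule fps_ext)
    fix n show "fps_nth ((1 + fps_const a * fps_X) * Abs_fps (\<lambda>j. (-1) ^ j * a ^ Suc j)) n
        = fps_nth (fps_const a) n"
      by (cases n) (simp_all add: distrib_right mult.assoc)
  qed
  have distr: "u * (e * p) + (u * q) * e = u * e * (q + p)" for u e p q :: "'b fps"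
    by (simp add: algebra_simps)
  have "fps_deriv (E D) = E D * P D"
    using assms
  proof (induction D rule: finite_induct)
    case empty
    then show ?case by (simp add: E_def P_def fps_eq_iff)
  next
    case (insert x F)
    have EI: "E (insert x F) = (1 + fps_const (f x) * fps_X) * E F"
      using insert by (simp add: E_def)
    have PI: "P (insert x F) = Abs_fps (\<lambda>j. (-1) ^ j * f x ^ Suc j) + P F"
      using insert by (intro fps_ext) (simp add: P_def distrib_left)
    have "fps_deriv (E (insert x F)) = (1 + fps_const (f x) * fps_X) * fps_deriv (E F) + fps_const (f x) * E F"
      unfolding EI fps_deriv_mult by simp
    also have "\<dots> = (1 + fps_const (f x) * fps_X) * (E F * P F)
        + ((1 + fps_const (f x) * fps_X) * Abs_fps (\<lambda>j. (-1) ^ j * f x ^ Suc j)) * E F"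
      by (simp only: insert.IH geom)
    also have "\<dots> = E (insert x F) * P (insert x F)"
      unfolding EI PI by (rule distr)
    finally show ?case .
  qed
  then have "fps_nth (fps_deriv (E D)) k = fps_nth (E D * P D) k" by simp
  then show ?thesis
    using assms by (simp add: fps_mult_nth E_def fps_nth_prod_esym P_def atLeast0AtMost)
qed

section \<open>The comparison sequence of rising factorials\<close>

lemma pochhammer_fact_mono:
  fixes x :: real
  assumes "x \<ge> 1" "i \<le> j"
  shows "pochhammer x i / fact i \<le> pochhammer x j / fact j"
  using assms(2)
proof (induction j rule: dec_induct)
  case (step j)
  \<comment> \<open>The ratio \<open>(x + j) / (1 + j)\<close> of consecutive terms is at least 1
    because \<open>x \<ge> 1\<close>.\<close>
  have "pochhammer x j / fact j * 1 \<le> pochhammer x j / fact j * ((x + j) / (1 + j))"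
    using assms(1) by (intro mult_left_mono divide_nonneg_pos pochhammer_nonneg) auto
  also have "\<dots> = pochhammer x (Suc j) / fact (Suc j)"
    by (simp add: pochhammer_Suc)
  finally show ?case using step by simp
qed simp

text \<open>These are the coefficients of \<open>(1 - X)^(-x)\<close>. The recurrence is Newton's
  identity with all signs positive and every power sum replaced by \<open>x\<close>, which makes the
  sequence a majorant for \<open>esym\<close>.\<close>

lemma pochhammer_fact_rec:
  fixes x :: real
  shows "real k * (pochhammer x k / fact k) = x * (\<Sum>i<k. pochhammer x i / fact i)"
proof (induction k)
  case (Suc k)
  have "real (Suc k) * (pochhammer x (Suc k) / fact (Suc k)) = (x + k) * (pochhammer x k / fact k)"
    by (simp add: pochhammer_Suc mult_ac)
  also have "\<dots> = x * (pochhammer x k / fact k) + real k * (pochhammer x k / fact k)"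
    by (rule distrib_right)
  finally show ?case by (simp only: Suc.IH sum.lessThan_Suc distrib_left add.commute)
qed simp

text \<open>Each index \<open>i\<close> counted on the left starts a block of \<open>d\<close> indices at which \<open>B\<close> is no smaller,
  and these blocks are disjoint.\<close>

lemma sum_residue_class_le:
  fixes B :: "nat \<Rightarrow> real"
  assumes "mono B" "\<And>i. B i \<ge> 0" "d > 0"
  shows "real d * (\<Sum>i | i < k \<and> d dvd k - i. B i) \<le> (\<Sum>i<k. B i)"
proof (induction k rule: less_induct)
  case (less k)
  show ?case
  proof (cases "k < d")
    case True
    then have "{i. i < k \<and> d dvd k - i} = {}"
      by (auto dest!: dvd_imp_le)
    then show ?thesis using assms(2) by (simp only: sum.empty) (simp add: sum_nonneg)
  next
    case False
    \<comment> \<open>The largest index counted for \<open>k\<close> is \<open>k - d\<close>; the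
      remaining ones are those counted for \<open>k - d\<close>, which the induction hypothesis
      covers.\<close>
    have "{i. i < k \<and> d dvd k - i} = insert (k - d) {i. i < k - d \<and> d dvd (k - d) - i}"
    proof (intro equalityI subsetI)
      fix i assume i: "i \<in> {i. i < k \<and> d dvd k - i}"
      then have le: "d \<le> k - i" by (auto intro!: dvd_imp_le)
      moreover have "d dvd k - d - i"
        using dvd_diff_nat[of d "k - i" d] i by (simp add: add.commute)
      ultimately show "i \<in> insert (k - d) {i. i < k - d \<and> d dvd (k - d) - i}"
        using assms(3) by (cases "i = k - d") auto
    next
      fix i assume i: "i \<in> insert (k - d) {i. i < k - d \<and> d dvd (k - d) - i}"
      show "i \<in> {i. i < k \<and> d dvd k - i}"
      proof (cases "i = k - d")
        case True
        then show ?thesis using False assms(3) by simp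
      next
        case ne: False
        then have "i < k - d" "d dvd (k - d - i) + d" using i by auto
        moreover from this have "(k - d - i) + d = k - i" by simp
        ultimately show ?thesis by simp
      qed
    qed
    then have "real d * (\<Sum>i | i < k \<and> d dvd k - i. B i)
        = real d * B (k - d) + real d * (\<Sum>i | i < k - d \<and> d dvd (k - d) - i. B i)"
      by (simp add: distrib_left)
    also have "real d * B (k - d) = (\<Sum>i=k-d..<k. B (k - d))"
      using False by simp
    also have "\<dots> \<le> (\<Sum>i=k-d..<k. B i)"
      by (intro sum_mono monoD[OF assms(1)]) auto
    also have "real d * (\<Sum>i | i < k - d \<and> d dvd (k - d) - i. B i) \<le> (\<Sum>i<k-d. B i)"
      using less.IH[of "k - d"] False assms(3) by simp
    also have "(\<Sum>i=k-d..<k. B i) + (\<Sum>i<k-d. B i) = (\<Sum>i<k. B i)"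
      using sum.atLeastLessThan_concat[of 0 "k - d" k B] by (simp add: atLeast0LessThan)
    finally show ?thesis by simp
  qed
qed

text \<open>Absolute values in Newton's identity give weight \<open>c\<close> to every earlier index
  \<open>i\<close> and an extra \<open>m\<close> when \<open>d dvd k - i\<close>. As the bounds are
  nondecreasing, the extra part costs at most \<open>m / d\<close> per index, and
  \<open>c + m / d \<le> x\<close> leads back to \<open>pochhammer_fact_rec\<close>.\<close>

lemma norm_esym_le:
  fixes f :: "'a \<Rightarrow> complex" and c m x :: real
  assumes fin: "finite D" and d: "d > 0" and m: "m \<ge> 0" and x: "x \<ge> 1" "c + m / real d \<le> x"
    and p: "\<And>j. j > 0 \<Longrightarrow> norm (\<Sum>a\<in>D. f a ^ j) \<le> (if d dvd j then c + m else c)"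
  shows "norm (esym k D f) \<le> pochhammer x k / fact k"
proof (induction k rule: less_induct)
  case (less k)
  define B where "B i = pochhammer x i / fact i" for i
  have B: "B i \<ge> 0" for i unfolding B_def using x by (intro divide_nonneg_pos pochhammer_nonneg) auto
  have monoB: "mono B" unfolding B_def using pochhammer_fact_mono[OF x(1)] by (intro monoI) auto
  show ?case
  proof (cases k)
    case 0
    have "{S. S \<subseteq> D \<and> card S = 0} = {{}}"
      using fin by (auto simp: card_eq_0_iff dest: finite_subset)
    then show ?thesis by (simp add: 0 esym_def)
  next
    case (Suc k')
    have "real k * norm (esym k D f) = norm (of_nat (Suc k') * esym (Suc k') D f)"
      by (simp only: Suc norm_mult norm_of_nat)
    also have "\<dots> = norm (\<Sum>i\<le>k'. esym i D f * ((-1) ^ (k' - i) * (\<Sum>a\<in>D. f a ^ Suc (k' - i))))"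
      by (simp only: newton_identity[OF fin])
    also have "\<dots> \<le> (\<Sum>i\<le>k'. norm (esym i D f) * norm (\<Sum>a\<in>D. f a ^ Suc (k' - i)))"
      by (intro sum_norm_le) (simp add: norm_mult norm_power)
    also have "\<dots> = (\<Sum>i<k. norm (esym i D f) * norm (\<Sum>a\<in>D. f a ^ (k - i)))"
      unfolding Suc lessThan_Suc_atMost by (intro sum.cong) (auto simp: Suc_diff_le)
    also have "\<dots> \<le> (\<Sum>i<k. B i * (c + (if d dvd k - i then m else 0)))"
    proof (intro sum_mono mult_mono)
      fix i assume "i \<in> {..<k}"
      then show "norm (esym i D f) \<le> B i" "norm (\<Sum>a\<in>D. f a ^ (k - i)) \<le> c + (if d dvd k - i then m else 0)"
        using less.IH[of i] p[of "k - i"] unfolding B_def by (auto split: if_splits)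
    qed (use B in auto)
    also have "\<dots> = c * (\<Sum>i<k. B i) + (\<Sum>i<k. if d dvd k - i then m * B i else 0)"
      by (simp add: sum_distrib_left flip: sum.distrib) (intro sum.cong refl; simp add: algebra_simps)
    also have "(\<Sum>i<k. if d dvd k - i then m * B i else 0) = m * (\<Sum>i | i < k \<and> d dvd k - i. B i)"
      by (simp add: sum.If_cases sum_distrib_left lessThan_def Collect_conj_eq[symmetric] Int_def)
    \<comment> \<open>The factor \<open>real d\<close> is split off to match
      \<open>sum_residue_class_le\<close>.\<close>
    also have "\<dots> = m / d * (real d * (\<Sum>i | i < k \<and> d dvd k - i. B i))"
      using d by simp
    also have "\<dots> \<le> m / d * (\<Sum>i<k. B i)"
      by (intro mult_left_mono sum_residue_class_le monoB B d) (use m in auto)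
    also have "c * (\<Sum>i<k. B i) + m / d * (\<Sum>i<k. B i) = (c + m / d) * (\<Sum>i<k. B i)"
      by (simp add: distrib_right)
    also have "\<dots> \<le> x * (\<Sum>i<k. B i)"
      by (intro mult_right_mono x sum_nonneg B)
    also have "\<dots> = real k * B k"
      unfolding B_def by (rule pochhammer_fact_rec[symmetric])
    finally have "norm (esym k D f) \<le> B k"
      using Suc by (simp only: mult_le_cancel_left_pos of_nat_0_less_iff zero_less_Suc)
    then show ?thesis by (simp only: B_def)
  qed
qed

subsection \<open>Orders of characters and the exponent\<close>

context comm_group begin

text \<open>If a prime \<open>p\<close> dividing the order of \<open>x\<close> did not divide the exponent, then a power of \<open>x\<close>
  times an element of maximal order would have order \<open>p\<close> times the exponent.\<close>

lemma prime_dvd_group_exponent: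
  assumes fin: "finite (carrier G)" and x: "x \<in> carrier G" and p: "prime p" "p dvd ord x"
  shows "p dvd group_exponent G"
proof (rule ccontr)
  assume np: "\<not> p dvd group_exponent G"
  define e where "e = group_exponent G"
  have finord: "finite (ord ` carrier G)" using fin by simp
  have "e \<in> ord ` carrier G"
    unfolding e_def group_exponent_def using finord by (intro Max_in) auto
  then obtain g where g: "g \<in> carrier G" "ord g = e" by auto
  have e0: "e > 0" using g ord_ge_1[OF fin g(1)] by simp
  define y where "y = x [^] (ord x div p)"
  have y: "y \<in> carrier G" using x by (simp add: y_def)
  have ordx: "ord x > 0" using ord_ge_1[OF fin x] by simp
  then have q: "ord x div p > 0" "ord x div p dvd ord x"
    using p by (auto simp: dvd_imp_le dvd_div_eq_0_iff)
  have ordy: "ord y = p"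
    using p q ordx by (auto simp: y_def ord_pow_gen[OF x] gcd_nat.absorb2 dvd_div_mult_self elim!: dvdE)
  define z where "z = g \<otimes> y"
  have z: "z \<in> carrier G" using g y by (simp add: z_def)
  have pow: "z [^] (i::nat) = g [^] i \<otimes> y [^] i" for i
    unfolding z_def using g y by (intro nat_pow_distrib)
  have cop: "coprime p e" using p(1) np prime_imp_coprime e_def by blast
  \<comment> \<open>The exponent \<open>p * ord z\<close> kills both \<open>z\<close> and
    \<open>y\<close>, hence also \<open>g\<close>. Below, \<open>e * ord z\<close> isolates
    \<open>y\<close> in the same way.\<close>
  have "z [^] (p * ord z) = \<one>"
    using z by (simp add: pow_eq_id)
  moreover have "y [^] (p * ord z) = \<one>" using y ordy by (simp add: pow_eq_id)
  ultimately have "g [^] (p * ord z) = \<one>" using g pow by simp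
  then have "e dvd p * ord z" using g by (simp add: pow_eq_id)
  then have 1: "e dvd ord z" using cop by (simp add: coprime_dvd_mult_right_iff coprime_commute)
  have "z [^] (e * ord z) = \<one>"
    using z by (simp add: pow_eq_id)
  moreover have "g [^] (e * ord z) = \<one>" using g by (simp add: pow_eq_id)
  ultimately have "y [^] (e * ord z) = \<one>" using y pow by simp
  then have "p dvd e * ord z" using y ordy by (simp add: pow_eq_id)
  then have "p dvd ord z" using cop by (simp add: coprime_dvd_mult_right_iff)
  then have "p * e dvd ord z" using 1 cop by (simp add: divides_mult)
  then have "p * e \<le> ord z" using ord_ge_1[OF fin z] by (intro dvd_imp_le) auto
  also have "\<dots> \<le> e"
    unfolding e_def group_exponent_def using finord z by simp
  finally show False using e0 prime_gt_1_nat[OF p(1)] by simp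
qed

lemma group_exponent_pos:
  assumes "finite (carrier G)"
  shows "group_exponent G > 0"
proof -
  have "group_exponent G \<in> ord ` carrier G"
    unfolding group_exponent_def using assms by (intro Max_in) auto
  then show ?thesis using ord_ge_1[OF assms] by fastforce
qed

text \<open>Here \<open>d\<close> is the order of \<open>\<chi>\<close> in the character group. A
  prime divisor \<open>p\<close> of \<open>d\<close> must divide the order of some group element,
  which ties it to the exponent; \<open>p \<le> order G\<close> serves the case \<open>c = 0\<close>
  of the final estimate.\<close>

lemma character_order:
  assumes fin: "finite (carrier G)" and \<chi>: "\<chi> \<in> characters G" "\<chi> \<noteq> trivial_char"
  obtains d p where "d > 0" "\<And>j. (\<forall>x\<in>carrier G. \<chi> x ^ j = 1) \<longleftrightarrow> d dvd j"
    "prime p" "p dvd d" "p dvd group_exponent G" "p \<le> order G"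
proof -
  define T where "T j \<longleftrightarrow> (\<forall>x\<in>carrier G. \<chi> x ^ j = 1)" for j
  have "order G > 0" "T (order G)"
    using char_pow_order[OF \<chi>(1)] fin by (auto simp: T_def order_gt_0_iff_finite)
  then have ex: "\<exists>j. j > 0 \<and> T j" by blast
  define d where "d = (LEAST j. j > 0 \<and> T j)"
  have d: "d > 0" "T d" using LeastI_ex[OF ex] by (auto simp: d_def)
  have dmin: "\<not> T j" if "0 < j" "j < d" for j
    using that not_less_Least[of j "\<lambda>j. j > 0 \<and> T j"] by (auto simp: d_def)
  have mod: "\<chi> x ^ j = \<chi> x ^ (j mod d)" if "x \<in> carrier G" for x j
  proof -
    have "\<chi> x ^ j = (\<chi> x ^ d) ^ (j div d) * \<chi> x ^ (j mod d)"
      by (simp flip: power_mult power_add)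
    then show ?thesis using d that by (simp add: T_def)
  qed
  have Td: "T j \<longleftrightarrow> d dvd j" for j
  proof -
    have "T j \<longleftrightarrow> T (j mod d)" unfolding T_def using mod by metis
    also have "\<dots> \<longleftrightarrow> j mod d = 0"
      using dmin[of "j mod d"] d(1) by (auto simp: T_def)
    finally show ?thesis by (simp add: dvd_eq_mod_eq_0)
  qed
  obtain y where "y \<in> carrier G" "\<chi> y \<noteq> 1" using char_nontrivialE[OF \<chi>] .
  then have "d \<noteq> 1" using d(2) by (auto simp: T_def)
  then obtain p where p: "prime p" "p dvd d" using prime_factor_nat by blast
  \<comment> \<open>Since \<open>d div p\<close> is no multiple of \<open>d\<close>, some
    \<open>x\<close> has \<open>\<chi> x ^ (d div p) \<noteq> 1\<close>; this value is a nontrivial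
    \<open>p\<close>-th root of unity.\<close>
  have "\<not> d dvd d div p"
    using p d(1) by (metis div_less_dividend dvd_div_eq_0_iff gr0I less_irrefl nat_dvd_not_less prime_gt_1_nat)
  then obtain x where x: "x \<in> carrier G" "\<chi> x ^ (d div p) \<noteq> 1"
    using Td[of "d div p"] by (auto simp: T_def)
  have "p dvd ord x"
  proof (rule ccontr)
    assume "\<not> p dvd ord x"
    then have cop: "coprime (ord x) p" using p(1) prime_imp_coprime coprime_commute by blast
    \<comment> \<open>Both \<open>u ^ p\<close> and \<open>u ^ ord x\<close> equal 1, so coprime
      exponents would force \<open>u = 1\<close> by Bezout.\<close>
    define u where "u = \<chi> x ^ (d div p)"
    have "u ^ p = 1" using d(2) p x by (simp add: u_def T_def flip: power_mult)
    moreover have "\<chi> x ^ ord x = 1"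
      using char_pow[OF \<chi>(1) x(1), of "ord x"] x char_one[OF \<chi>(1)] by simp
    then have "u ^ ord x = 1"
      by (simp add: u_def) (metis mult.commute power_mult power_one)
    moreover obtain s t where "ord x * s = p * t + 1"
      using coprime_bezout_strong[OF cop] prime_gt_1_nat[OF p(1)] by auto
    ultimately have "u = 1"
      by (metis power_add power_mult power_one power_one_right mult_1)
    then show False using x by (simp add: u_def)
  qed
  moreover from this have "p \<le> order G"
    using ord_dvd_group_order[OF x(1)] \<open>order G > 0\<close> by (meson dvd_imp_le dvd_trans)
  ultimately show ?thesis
    using that[OF d(1) _ p] Td prime_dvd_group_exponent[OF fin x(1) p(1)] unfolding T_def by blast
qed

text \<open>The \<open>j\<close>-th power of \<open>\<chi>\<close> is a nontrivial character, so its
  sum over \<open>D\<close> is minus its sum over the complement, where all terms have modulus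
  1.\<close>

lemma norm_char_power_sum_le:
  assumes fin: "finite (carrier G)" and D: "D \<subseteq> carrier G" and \<chi>: "\<chi> \<in> characters G"
    and y: "y \<in> carrier G" "\<chi> y ^ j \<noteq> 1"
  shows "norm (\<Sum>x\<in>D. \<chi> x ^ j) \<le> real (order G - card D)"
proof -
  define \<psi> where "\<psi> = (\<lambda>x\<in>carrier G. \<chi> x ^ j)"
  have "(\<Sum>x\<in>carrier G. \<chi> x ^ j) = (\<Sum>x\<in>carrier G. \<psi> x)" by (simp add: \<psi>_def)
  also have "\<dots> = 0"
  proof (rule char_sum_carrier[OF _ fin y(1)])
    show "\<psi> \<in> characters G" unfolding \<psi>_def by (rule char_power_character[OF \<chi>])
    show "\<psi> y \<noteq> 1" using y by (simp add: \<psi>_def)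
  qed
  finally have "(\<Sum>x\<in>D. \<chi> x ^ j) = - (\<Sum>x\<in>carrier G - D. \<chi> x ^ j)"
    using sum.subset_diff[OF D fin, of "\<lambda>x. \<chi> x ^ j"] by (simp add: add_eq_0_iff)
  then have "norm (\<Sum>x\<in>D. \<chi> x ^ j) \<le> (\<Sum>x\<in>carrier G - D. norm (\<chi> x ^ j))"
    by (simp add: norm_sum)
  also have "\<dots> = real (order G - card D)"
    using fin D by (simp add: norm_power char_norm[OF \<chi> fin] card_Diff_subset finite_subset order_def)
  finally show ?thesis .
qed

end

section \<open>Bounding the contribution of the nontrivial characters\<close>

theorem theorem1p1:
  fixes G (structure) and D :: "'a set" and b :: 'a and c k :: nat
  assumes "comm_group G"
    and "finite (carrier G)"
    and "D \<subseteq> carrier G"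
    and "int (card D) = int (order G) - int c"
    and "card D \<ge> c"
    and "b \<in> carrier G"
    and "k \<le> card D"
  shows "\<bar>real (subset_sum_count G D k b)
            - 1 / real (order G) * ((real (order G) - real c) gchoose k)\<bar>
         \<le> (real c + (real (order G) - 2 * real c)
               * (\<Sum>i | i dvd group_exponent G \<and> moebius_mu i = -1. 1 / real i)
             + real k - 1) gchoose k"
proof -
  interpret comm_group G by fact
  note fin = assms(2) and D = assms(3) and b = assms(6)
  define n where "n = order G"
  define m where "m = real n - 2 * real c"
  define \<sigma> where "\<sigma> = (\<Sum>i | i dvd group_exponent G \<and> moebius_mu i = -1. 1 / real i)"
  define x where "x = real c + m * \<sigma>"
  \<comment> \<open>The claimed bound \<open>(x + k - 1) gchoose k\<close> as a rising
    factorial.\<close>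
  define B where "B = pochhammer x k / fact k"
  have n0: "n > 0" using fin by (simp add: n_def order_gt_0_iff_finite)
  have nD: "n = card D + c" using assms(4) by (simp add: n_def)
  have m0: "m \<ge> 0" using nD assms(5) by (simp add: m_def)
  have finD: "finite D" using fin D finite_subset by blast
  have x0: "x \<ge> 0" using m0 by (simp add: x_def \<sigma>_def sum_nonneg)
  \<comment> \<open>Only \<open>x \<ge> 0\<close> is available at this point: \<open>x\<close> is 0
    for the trivial group, and \<open>x \<ge> 1\<close> is derived below from a nontrivial
    character.\<close>
  have B0: "B \<ge> 0" using x0 unfolding B_def
    by (cases k) (auto intro!: divide_nonneg_pos simp: pochhammer_prod prod_nonneg)
  have \<sigma>: "1 / real p \<le> \<sigma>" if p: "prime p" "p dvd group_exponent G" for p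
  proof -
    have "moebius_mu p = -1"
      using p(1) by (simp add: moebius_mu_def squarefree_prime prime_prime_factors)
    moreover have "finite {i. i dvd group_exponent G \<and> moebius_mu i = -1}"
      by (rule finite_subset[OF _ finite_divisors_nat[OF group_exponent_pos[OF fin]]]) auto
    ultimately show ?thesis
      unfolding \<sigma>_def using p by (intro member_le_sum) auto
  qed
  have bound: "norm (esym k D \<chi>) \<le> B" if \<chi>: "\<chi> \<in> characters G" "\<chi> \<noteq> trivial_char" for \<chi>
  proof -
    obtain d p where d: "d > 0" "\<And>j. (\<forall>x\<in>carrier G. \<chi> x ^ j = 1) \<longleftrightarrow> d dvd j"
      and p: "prime p" "p dvd d" "p dvd group_exponent G" "p \<le> order G"
      using character_order[OF fin \<chi>] by metis
    have p0: "p > 0" using p(1) by (simp add: prime_gt_0_nat)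
    have "p \<le> d" using p(2) d(1) by (rule dvd_imp_le)
    then have "1 / real d \<le> 1 / real p" using p0 by (intro divide_left_mono) auto
    also note \<sigma>[OF p(1,3)]
    finally have "m * (1 / real d) \<le> m * \<sigma>" using m0 by (rule mult_left_mono)
    then have xd: "real c + m / real d \<le> x" by (simp add: x_def)
    \<comment> \<open>For \<open>c > 0\<close> this is immediate. For \<open>c = 0\<close> one has
      \<open>m = n\<close>, and the term \<open>1 / p\<close> of \<open>\<sigma>\<close> with
      \<open>p \<le> n\<close> already gives \<open>n * \<sigma> \<ge> 1\<close>.\<close>
    have x1: "x \<ge> 1"
    proof (cases "c = 0")
      case True
      have "1 = real p * (1 / real p)" using p0 by simp
      also have "\<dots> \<le> real n * \<sigma>"
        using p(4) \<sigma>[OF p(1,3)] by (intro mult_mono) (auto simp: n_def)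
      finally show ?thesis by (simp add: x_def m_def True)
    next
      case False
      have "0 \<le> m * \<sigma>" using m0 by (simp add: \<sigma>_def sum_nonneg)
      then show ?thesis using False by (simp add: x_def)
    qed
    show ?thesis
      unfolding B_def
    proof (rule norm_esym_le[OF finD d(1) m0 x1 xd])
      fix j :: nat
      show "norm (\<Sum>a\<in>D. \<chi> a ^ j) \<le> (if d dvd j then real c + m else real c)"
      proof (cases "d dvd j")
        case True
        then have "(\<Sum>a\<in>D. \<chi> a ^ j) = (\<Sum>a\<in>D. 1)"
          using d(2)[of j] D by (intro sum.cong) auto
        then show ?thesis using True nD by (simp add: m_def)
      next
        case False
        then obtain y where "y \<in> carrier G" "\<chi> y ^ j \<noteq> 1" using d(2) by blast
        from norm_char_power_sum_le[OF fin D \<chi>(1) this] show ?thesis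
          using False nD by (simp add: n_def)
      qed
    qed
  qed
  define N where "N = subset_sum_count G D k b"
  have finch: "finite (characters G)" using fin by (rule finite_characters)
  \<comment> \<open>The trivial character contributes the main term, since each of its products is
    1.\<close>
  have triv: "trivial_char (inv b) * esym k D trivial_char = of_nat (card D choose k)"
  proof -
    have "esym k D trivial_char = (\<Sum>S | S \<subseteq> D \<and> card S = k. 1)"
      unfolding esym_def using D by (intro sum.cong prod.neutral refl) (auto simp: trivial_char_def)
    then show ?thesis using b n_subsets[OF finD] by (simp add: trivial_char_def)
  qed
  have "of_nat n * of_nat N = (\<Sum>\<chi>\<in>characters G. \<chi> (inv b) * esym k D \<chi>)"
    using subset_sum_count_characters[OF fin D b] by (simp add: N_def n_def esym_def)
  also have "\<dots> = of_nat (card D choose k) + (\<Sum>\<chi>\<in>characters G - {trivial_char}. \<chi> (inv b) * esym k D \<chi>)"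
    unfolding triv[symmetric] by (rule sum.remove[OF finch trivial_char_in])
  finally have "complex_of_real (real n * real N - real (card D choose k))
      = (\<Sum>\<chi>\<in>characters G - {trivial_char}. \<chi> (inv b) * esym k D \<chi>)"
    by simp
  then have "\<bar>real n * real N - real (card D choose k)\<bar>
      = norm (\<Sum>\<chi>\<in>characters G - {trivial_char}. \<chi> (inv b) * esym k D \<chi>)"
    by (metis norm_of_real)
  also have "\<dots> \<le> (\<Sum>\<chi>\<in>characters G - {trivial_char}. B)"
    using b by (intro sum_norm_le) (auto simp: norm_mult char_norm[OF _ fin] bound)
  \<comment> \<open>There are \<open>n - 1\<close> nontrivial characters; rounding up to
    \<open>n\<close> cancels the later division by \<open>n\<close>.\<close>
  also have "\<dots> \<le> real n * B"
    using B0 finch trivial_char_in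
    by (simp add: card_characters[OF fin] n_def mult_right_mono)
  finally have "\<bar>real N - real (card D choose k) / real n\<bar> \<le> B"
    using n0 by (simp add: abs_le_iff field_simps)
  moreover have "real (card D choose k) = (real n - real c) gchoose k"
    using nD by (simp add: binomial_gbinomial)
  moreover have "B = (x + real k - 1) gchoose k"
    by (simp add: B_def gbinomial_pochhammer')
  ultimately show ?thesis
    by (simp add: N_def n_def x_def m_def \<sigma>_def)
qed

end
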